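(* Let $n,m\in\mathbb{P}$ with $m\le n$ and $l=2m-n\geq 1$, and let $\mathcal{J}_{n,m}$ be the joint-covariant $$\mathcal{J}_{n,m}(\ldots;a_{i0},a_{i1},\ldots,a_{in_i};\ldots;x_0,y_0)=\mathbf{U}\prod_{1\leq i<j\leq n-m+1}[j\;i]\prod_{0\leq i<j\leq m}[j\;i]$$ of generic forms of degrees $(n_1,\ldots,n_l)=(n,m,\ldots,m)$, where $1,2,\ldots,n-m+1\in\mathbb{P}_1$, $n-m+2\in\mathbb{P}_2$, $\ldots$, $m\in\mathbb{P}_l$. Then $$\mathcal{J}_{n,m}(\ldots;a_{i0},a_{i1},\ldots,a_{in_i};\ldots;x_0,y_0)=(n-m+1)!\,\begin{vmatrix} y_0^m&x_0y_0^{m-1}&x_0^2y_0^{m-2}&\cdots&x_0^m\\ a_{1\,0}&a_{1\,1}&a_{1\,2}&\cdots&a_{1\,m}\\ a_{1\,1}&a_{1\,2}&a_{1\,3}&\cdots&a_{1\,m+1}\\ \vdots&\vdots&\vdots&&\vdots\\ a_{1\,n-m}&a_{1\,n-m+1}&a_{1\,n-m+2}&\cdots&a_{1\,n}\\ a_{2\,0}&a_{2\,1}&a_{2\,2}&\cdots&a_{2\,m}\\ \vdots&\vdots&\vdots&&\vdots\\ a_{l\,0}&a_{l\,1}&a_{l\,2}&\cdots&a_{l\,m} \end{vmatrix}.$$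
   Context: $\mathbb{F}$ is a field of characteristic zero, $\mathbb{N}$ is the set of nonnegative integers, $\mathbb{P}$ the set of positive integers. $\mathbb{F}[\boldsymbol{x},\boldsymbol{y}]$ is the polynomial ring in the indeterminates $x_i,y_i$ ($i\in\mathbb{N}$). Brackets are $[i\;j]=x_iy_j-x_jy_i$. Umbral operator: given degrees $(n_1,\ldots,n_l)$, a partition of $\mathbb{P}$ into pairwise disjoint infinite sets $\mathbb{P}_1,\ldots,\mathbb{P}_l$, and independent indeterminates $a_{j0},\ldots,a_{jn_j}$ ($1\le j\le l$), $\mathbf{U}$ is the linear operator from $\mathbb{F}[\boldsymbol{x},\boldsymbol{y}]$ to the polynomial ring over $\mathbb{F}$ in the $a_{jk}$ and $x_0,y_0$ which is multiplicative over distinct indices (the product being over the indices whose pair occurs in the monomial, so $\mathbf{U}\,1=1$) and satisfies $\mathbf{U}\,x_0^{k_1}y_0^{k_2}=x_0^{k_1}y_0^{k_2}$, and for $i\in\mathbb{P}_j$, $(k_1,k_2)\ne(0,0)$: $\mathbf{U}\,x_i^{k_1}y_i^{k_2}=a_{jk_1}$ if $k_1+k_2=n_j$, and $=0$ otherwise. In the determinant (of order $m+1$) the rows are: the row $(x_0^{c}y_0^{m-c})_{0\le c\le m}$; the $n-m+1$ rows $(a_{1\,k+c})_{0\le c\le m}$ for $k=0,\ldots,n-m$; and the $l-1$ rows $(a_{j\,c})_{0\le c\le m}$ for $j=2,\ldots,l$. Empty products equal $1$. *)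

theory Defs
  imports "HOL-Library.Poly_Mapping" "HOL-Library.Disjoint_Sets"
    "Jordan_Normal_Form.Determinant"
begin

text \<open>Polynomials over \<open>'a\<close> in the indeterminates \<open>'v\<close> are finitely supported maps from
  monomials (finitely supported exponent maps) to coefficients; the ring structure is the
  convolution product of \<^theory>\<open>HOL-Library.Poly_Mapping\<close>.\<close>

type_synonym ('v, 'a) mpoly = "('v \<Rightarrow>\<^sub>0 nat) \<Rightarrow>\<^sub>0 'a"

definition Var :: "'v \<Rightarrow> ('v, 'a::comm_ring_1) mpoly" where
  "Var v = Poly_Mapping.single (Poly_Mapping.single v 1) 1"

definition Const :: "'a \<Rightarrow> ('v, 'a::comm_ring_1) mpoly" where
  "Const c = Poly_Mapping.single 0 c"

datatype xy_var = X nat | Y nat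

text \<open>\<open>A j k\<close> is the coefficient $a_{jk}$ of the $j$-th generic form.  All pairs of naturals are
  allowed as subscripts; only those with $1 \le j \le l$ and $k \le n_j$ occur in the image of the
  umbral operator.\<close>

datatype form_var = A nat nat | X0 | Y0

definition bracket :: "nat \<Rightarrow> nat \<Rightarrow> (xy_var, 'a::comm_ring_1) mpoly" where
  "bracket i j = Var (X i) * Var (Y j) - Var (X j) * Var (Y i)"

definition infinite_partition :: "nat \<Rightarrow> (nat \<Rightarrow> nat set) \<Rightarrow> bool" where
  "infinite_partition l P \<longleftrightarrow>
     (\<Union>j\<in>{1..l}. P j) = {1..} \<and> disjoint_family_on P {1..l} \<and> (\<forall>j\<in>{1..l}. infinite (P j))"

definition monom_indices :: "(xy_var \<Rightarrow>\<^sub>0 nat) \<Rightarrow> nat set" where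
  "monom_indices t = {i. Poly_Mapping.lookup t (X i) \<noteq> 0 \<or> Poly_Mapping.lookup t (Y i) \<noteq> 0}"

text \<open>The image of $x_i^{k_1} y_i^{k_2}$ for $(k_1,k_2) \neq (0,0)$; \<open>d\<close> lists the degrees $n_j$.\<close>

definition umbral_pair ::
  "nat \<Rightarrow> (nat \<Rightarrow> nat) \<Rightarrow> (nat \<Rightarrow> nat set) \<Rightarrow> nat \<Rightarrow> nat \<Rightarrow> nat \<Rightarrow> (form_var, 'a::comm_ring_1) mpoly" where
  "umbral_pair l d P i k1 k2 =
     (if i = 0 then Var X0 ^ k1 * Var Y0 ^ k2
      else let j = (THE j. j \<in> {1..l} \<and> i \<in> P j)
           in if k1 + k2 = d j then Var (A j k1) else 0)"

definition umbral_monom ::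
  "nat \<Rightarrow> (nat \<Rightarrow> nat) \<Rightarrow> (nat \<Rightarrow> nat set) \<Rightarrow> (xy_var \<Rightarrow>\<^sub>0 nat) \<Rightarrow> (form_var, 'a::comm_ring_1) mpoly" where
  "umbral_monom l d P t =
     (\<Prod>i\<in>monom_indices t.
        umbral_pair l d P i (Poly_Mapping.lookup t (X i)) (Poly_Mapping.lookup t (Y i)))"

definition umbral ::
  "nat \<Rightarrow> (nat \<Rightarrow> nat) \<Rightarrow> (nat \<Rightarrow> nat set) \<Rightarrow> (xy_var, 'a::comm_ring_1) mpoly \<Rightarrow> (form_var, 'a) mpoly" where
  "umbral l d P p =
     (\<Sum>t\<in>Poly_Mapping.keys p. Const (Poly_Mapping.lookup p t) * umbral_monom l d P t)"

definition form_degrees :: "nat \<Rightarrow> nat \<Rightarrow> nat \<Rightarrow> nat" where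
  "form_degrees n m j = (if j = 1 then n else m)"

definition joint_covariant ::
  "nat \<Rightarrow> nat \<Rightarrow> (nat \<Rightarrow> nat set) \<Rightarrow> (form_var, 'a::comm_ring_1) mpoly" where
  "joint_covariant n m P =
     umbral (2 * m - n) (form_degrees n m) P
       ((\<Prod>(i, j)\<in>{(i, j). 1 \<le> i \<and> i < j \<and> j \<le> n - m + 1}. bracket j i) *
        (\<Prod>(i, j)\<in>{(i, j). i < j \<and> j \<le> m}. bracket j i))"

text \<open>Row \<open>0\<close> holds the powers of $x_0, y_0$, rows \<open>1, \<dots>, n - m + 1\<close> the shifted coefficients of
  the first form, and row \<open>n - m + j\<close> with \<open>2 \<le> j\<close> the coefficients of the \<open>j\<close>-th form.\<close>

definition covariant_matrix :: "nat \<Rightarrow> nat \<Rightarrow> (form_var, 'a::comm_ring_1) mpoly mat" where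
  "covariant_matrix n m = mat (m + 1) (m + 1) (\<lambda>(r, c).
     if r = 0 then Var X0 ^ c * Var Y0 ^ (m - c)
     else if r \<le> n - m + 1 then Var (A 1 ((r - 1) + c))
     else Var (A (r - (n - m)) c))"

text \<open>The properties that characterise the umbral operator.\<close>

lemma umbral_single: "umbral l d P (Poly_Mapping.single t c) = Const c * umbral_monom l d P t"
  by (cases "c = 0") (simp_all add: umbral_def Const_def)

lemma umbral_superset:
  assumes "finite S" "Poly_Mapping.keys p \<subseteq> S"
  shows "umbral l d P p = (\<Sum>t\<in>S. Const (Poly_Mapping.lookup p t) * umbral_monom l d P t)"
  unfolding umbral_def
  by (rule sum.mono_neutral_left) (use assms in \<open>auto simp: Const_def in_keys_iff\<close>)

lemma umbral_add: "umbral l d P (p + q) = umbral l d P p + umbral l d P q"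
proof -
  let ?S = "Poly_Mapping.keys p \<union> Poly_Mapping.keys q"
  have S: "finite ?S" "Poly_Mapping.keys p \<subseteq> ?S" "Poly_Mapping.keys q \<subseteq> ?S"
      "Poly_Mapping.keys (p + q) \<subseteq> ?S"
    using Poly_Mapping.keys_add[of p q] by auto
  show ?thesis
    unfolding umbral_superset[OF S(1,2)] umbral_superset[OF S(1,3)] umbral_superset[OF S(1,4)]
    by (simp add: lookup_add Const_def single_add distrib_right sum.distrib)
qed

lemma umbral_one: "umbral l d P 1 = 1"
  using umbral_single[of l d P 0 1]
  by (simp add: umbral_monom_def monom_indices_def Const_def single_one)

lemma Var_power: "Var v ^ k = Poly_Mapping.single (Poly_Mapping.single v k) 1"
  by (induction k) (simp_all add: Var_def mult_single single_one flip: single_add)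

lemma umbral_scale: "umbral l d P (Const c * p) = Const c * umbral l d P p"
proof -
  have lk: "Poly_Mapping.lookup (Const c * p) t = c * Poly_Mapping.lookup p t" for t
    by (simp add: Const_def map.rep_eq when_def flip: mult_map_scale_conv_mult)
  then have "Poly_Mapping.keys (Const c * p) \<subseteq> Poly_Mapping.keys p"
    by (auto simp: in_keys_iff)
  then have "umbral l d P (Const c * p) = (\<Sum>t\<in>Poly_Mapping.keys p.
      Const (c * Poly_Mapping.lookup p t) * umbral_monom l d P t)"
    by (simp only: umbral_superset[OF finite_keys] lk)
  also have "\<dots> = Const c * umbral l d P p"
    by (simp add: umbral_def sum_distrib_left Const_def mult_single flip: mult.assoc)
  finally show ?thesis .
qed

lemma umbral_pair_powers:
  assumes "(k1, k2) \<noteq> (0, 0)"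
  shows "umbral l d P (Var (X i) ^ k1 * Var (Y i) ^ k2) = umbral_pair l d P i k1 k2"
proof -
  let ?t = "Poly_Mapping.single (X i) k1 + Poly_Mapping.single (Y i) k2"
  have "monom_indices ?t = {i}"
    using assms by (auto simp: monom_indices_def lookup_add lookup_single when_def)
  then show ?thesis
    by (simp add: Var_power mult_single umbral_single umbral_monom_def Const_def single_one
        lookup_add lookup_single)
qed

lemma umbral_x0_y0: "umbral l d P (Var (X 0) ^ k1 * Var (Y 0) ^ k2) = Var X0 ^ k1 * Var Y0 ^ k2"
  by (cases "(k1, k2) = (0, 0)") (auto simp: umbral_one umbral_pair_powers umbral_pair_def)

lemma umbral_xi_yi:
  assumes "infinite_partition l P" "j \<in> {1..l}" "i \<in> P j" "(k1, k2) \<noteq> (0, 0)"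
  shows "umbral l d P (Var (X i) ^ k1 * Var (Y i) ^ k2) =
    (if k1 + k2 = d j then Var (A j k1) else 0)"
proof -
  have "i \<in> {1..}"
    using assms unfolding infinite_partition_def by blast
  moreover have "(THE j. j \<in> {1..l} \<and> i \<in> P j) = j"
    using assms unfolding infinite_partition_def disjoint_family_on_def by (intro the_equality) blast+
  ultimately show ?thesis
    by (simp add: umbral_pair_powers[OF assms(4)] umbral_pair_def)
qed

lemma finite_monom_indices: "finite (monom_indices t)"
proof (rule finite_subset)
  show "monom_indices t \<subseteq> (\<lambda>v. case v of X i \<Rightarrow> i | Y i \<Rightarrow> i) ` Poly_Mapping.keys t"
    unfolding monom_indices_def by (force simp: in_keys_iff image_iff split: xy_var.splits)
qed simp

lemma umbral_mult_distinct_indices: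
  assumes "monom_indices s \<inter> monom_indices t = {}"
  shows "umbral l d P (Poly_Mapping.single s 1 * Poly_Mapping.single t 1) =
    umbral l d P (Poly_Mapping.single s 1) * umbral l d P (Poly_Mapping.single t 1)"
proof -
  have un: "monom_indices (s + t) = monom_indices s \<union> monom_indices t"
    by (auto simp: monom_indices_def lookup_add)
  have s: "Poly_Mapping.lookup (s + t) (X i) = Poly_Mapping.lookup s (X i)"
    "Poly_Mapping.lookup (s + t) (Y i) = Poly_Mapping.lookup s (Y i)" if "i \<in> monom_indices s" for i
    using that assms by (auto simp: monom_indices_def lookup_add disjoint_iff)
  have t: "Poly_Mapping.lookup (s + t) (X i) = Poly_Mapping.lookup t (X i)"
    "Poly_Mapping.lookup (s + t) (Y i) = Poly_Mapping.lookup t (Y i)" if "i \<in> monom_indices t" for i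
    using that assms by (auto simp: monom_indices_def lookup_add disjoint_iff)
  show ?thesis
    by (simp add: mult_single umbral_single Const_def single_one umbral_monom_def un
        prod.union_disjoint finite_monom_indices assms s t)
qed

end

theory Submission
  imports Defs "HOL-Computational_Algebra.Polynomial"
begin

text \<open>
  Both products of brackets are homogeneous Vandermonde determinants
  (\<open>homogeneous_vandermonde\<close>): the second one is the determinant $V$ of the matrix with entries
  $x_i^c y_i^{m-c}$, $0 \le i, c \le m$, and the first one is, with $k = n - m$, the Leibniz sum
  over the permutations $\sigma$ of $\{0, \ldots, k\}$ of
  $\mathrm{sgn}(\sigma) \prod_i x_{i+1}^{\sigma(i)} y_{i+1}^{k-\sigma(i)}$.

  In $V$ every index $i$ occurs in row $i$ only, and the operator $\mathbf{U}$ is multiplicative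
  over distinct indices.  Hence $\mathbf{U}$ may be applied to such a determinant entry by entry
  (\<open>umbral_det\<close>), and this stays true after each row has been multiplied by a monomial in its
  own pair of indeterminates.  Expanding only the first factor therefore gives
  $\mathcal{J}_{n,m} = \sum_\sigma \mathrm{sgn}(\sigma) \det C_\sigma$, where row $i + 1$ of
  $C_\sigma$, for $0 \le i \le k$, is the image of $x_{i+1}^{\sigma(i)+c} y_{i+1}^{n-\sigma(i)-c}$,
  that is, $a_{1\,\sigma(i)+c}$.  The total degree of these monomials is $k + m = n$, and in a row
  $i > k + 1$ it is $m$, so every degree condition in the definition of $\mathbf{U}$ is met and no
  entry is killed (\<open>umbral_pair_covariant_matrix\<close>).

  The matrix $C_\sigma$ is thus the matrix $C$ of the claim with its rows $1, \ldots, k + 1$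
  permuted by $\sigma$, and $\det C_\sigma = \mathrm{sgn}(\sigma) \det C$.  The two signs cancel, and
  each of the $(k + 1)!$ permutations contributes $\det C$.
\<close>

section \<open>The homogeneous Vandermonde determinant\<close>

lemma det_scale_rows:
  fixes f :: "nat \<Rightarrow> nat \<Rightarrow> 'a::comm_ring_1"
  shows "det (mat n n (\<lambda>(i, j). a i * f i j)) = (\<Prod>i<n. a i) * det (mat n n (\<lambda>(i, j). f i j))"
proof -
  have "p i < n" if "p permutes {0..<n}" "i < n" for p i
    using permutes_in_image[OF that(1), of i] that(2) by simp
  then show ?thesis
    by (subst (1 2) det_def')
      (auto simp: prod.distrib atLeast0LessThan sum_distrib_left mult_ac intro!: sum.cong)
qed

text \<open>Subtracting $x_0$ times column $c - 1$ from $y_0$ times column $c$, for all $c \ge 1$, clears row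
  $0$ outside its first entry $y_0^{k+1}$ and produces the factor $x_i y_0 - x_0 y_i$ in the rest of
  every other row.  This column operation is multiplication by an upper triangular matrix of
  determinant $y_0^{k+1}$, which is why that factor appears on the left-hand side.\<close>

lemma vandermonde_step:
  fixes x y :: "nat \<Rightarrow> 'a::comm_ring_1"
  shows "y 0 ^ Suc k * det (mat (Suc (Suc k)) (Suc (Suc k)) (\<lambda>(i, c). x i ^ c * y i ^ (Suc k - c))) =
    y 0 ^ Suc k * ((\<Prod>i<Suc k. x (Suc i) * y 0 - x 0 * y (Suc i)) *
      det (mat (Suc k) (Suc k) (\<lambda>(i, c). x (Suc i) ^ c * y (Suc i) ^ (k - c))))"
proof -
  let ?n = "Suc (Suc k)"
  define V where "V = mat ?n ?n (\<lambda>(i, c). x i ^ c * y i ^ (Suc k - c))"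
  define B where "B = mat ?n ?n (\<lambda>(r, c). if r = c then (if c = 0 then 1 else y 0)
    else if Suc r = c then - x 0 else 0)"
  have carr: "V \<in> carrier_mat ?n ?n" "B \<in> carrier_mat ?n ?n"
    by (auto simp: V_def B_def)
  have "det B = prod_list (diag_mat B)"
    by (rule det_upper_triangular[OF _ carr(2)]) (auto simp: B_def)
  also have "\<dots> = (\<Prod>i<?n. if i = 0 then 1 else y 0)"
    unfolding prod_list_diag_prod by (simp add: B_def atLeast0LessThan)
  also have "\<dots> = y 0 ^ Suc k"
    by (subst prod.lessThan_Suc_shift) simp
  finally have det_B: "det B = y 0 ^ Suc k" .
  have VB: "(V * B) $$ (i, c) =
      (if c = 0 then y i ^ Suc k
       else x i ^ (c - 1) * y i ^ (Suc k - c) * (x i * y 0 - x 0 * y i))"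
    if "i < ?n" "c < ?n" for i c
  proof -
    have "(V * B) $$ (i, c) = (\<Sum>r<?n. V $$ (i, r) * B $$ (r, c))"
      using that carr by (simp add: scalar_prod_def atLeast0LessThan del: sum.lessThan_Suc)
    also have "\<dots> = (\<Sum>r\<in>(if c = 0 then {0} else {c - 1, c}). V $$ (i, r) * B $$ (r, c))"
      by (rule sum.mono_neutral_right) (use that in \<open>auto simp: B_def\<close>)
    also have "\<dots> = (if c = 0 then y i ^ Suc k
       else x i ^ (c - 1) * y i ^ (Suc k - c) * (x i * y 0 - x 0 * y i))"
    proof (cases c)
      case 0
      then show ?thesis using that by (simp add: V_def B_def)
    next
      case (Suc d)
      then have "y i ^ (Suc k - d) = y i * y i ^ (k - d)"
        using that by (simp add: Suc_diff_le)
      then show ?thesis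
        using that Suc by (simp add: V_def B_def algebra_simps)
    qed
    finally show ?thesis .
  qed
  have VBc: "V * B \<in> carrier_mat ?n ?n"
    using carr by simp
  have "det (V * B) = (\<Sum>c<?n. (V * B) $$ (0, c) * cofactor (V * B) 0 c)"
    by (rule laplace_expansion_row[OF VBc]) simp
  also have "\<dots> = (\<Sum>c\<in>{0}. (V * B) $$ (0, c) * cofactor (V * B) 0 c)"
    by (rule sum.mono_neutral_right) (auto simp: VB)
  also have "\<dots> = y 0 ^ Suc k * det (mat_delete (V * B) 0 0)"
    by (simp add: VB cofactor_def)
  also have "mat_delete (V * B) 0 0 = mat (Suc k) (Suc k) (\<lambda>(i, c).
      (x (Suc i) * y 0 - x 0 * y (Suc i)) * (x (Suc i) ^ c * y (Suc i) ^ (k - c)))"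
    using VBc by (intro eq_matI) (auto simp: mat_delete_def VB mult_ac simp del: index_mult_mat)
  finally show ?thesis
    by (simp add: det_mult[OF carr] det_B det_scale_rows mult.commute flip: V_def
        del: prod.lessThan_Suc power_Suc)
qed

lemma prod_pairs_shift:
  fixes f :: "nat \<Rightarrow> nat \<Rightarrow> 'a::comm_monoid_mult"
  shows "(\<Prod>(i, j)\<in>{(i, j). i < j \<and> j \<le> Suc k}. f i j) =
    (\<Prod>i<Suc k. f 0 (Suc i)) * (\<Prod>(i, j)\<in>{(i, j). i < j \<and> j \<le> k}. f (Suc i) (Suc j))"
proof -
  let ?A = "Pair 0 ` Suc ` {..<Suc k}" and ?B = "map_prod Suc Suc ` {(i, j). i < j \<and> j \<le> k}"
  have "p \<in> ?A \<union> ?B" if "p \<in> {(i, j). i < j \<and> j \<le> Suc k}" for p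
    using that by (cases "fst p"; cases "snd p") (auto simp: image_iff)
  moreover have "?A \<union> ?B \<subseteq> {(i, j). i < j \<and> j \<le> Suc k}"
    by auto
  ultimately have split: "{(i, j). i < j \<and> j \<le> Suc k} = ?A \<union> ?B"
    by blast
  have "finite {(i, j). i < j \<and> j \<le> k}"
    by (rule finite_subset[of _ "{..k} \<times> {..k}"]) auto
  then have "(\<Prod>(i, j)\<in>?A \<union> ?B. f i j) = (\<Prod>(i, j)\<in>?A. f i j) * (\<Prod>(i, j)\<in>?B. f i j)"
    by (intro prod.union_disjoint) auto
  also have "(\<Prod>(i, j)\<in>?A. f i j) = (\<Prod>i<Suc k. f 0 (Suc i))"
    by (subst prod.reindex; (subst prod.reindex)?) (auto simp: inj_on_def simp del: prod.lessThan_Suc)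
  also have "(\<Prod>(i, j)\<in>?B. f i j) = (\<Prod>(i, j)\<in>{(i, j). i < j \<and> j \<le> k}. f (Suc i) (Suc j))"
    by (subst prod.reindex) (auto simp: inj_on_def case_prod_unfold)
  finally show ?thesis
    unfolding split .
qed

text \<open>The factor $y_0^{k+1}$ of the recursion has to be divided out, so this induction works
  over rings in which the $y_i$ are not zero divisors.\<close>

lemma vandermonde_cancel:
  fixes x y :: "nat \<Rightarrow> 'a::comm_ring_1"
  assumes "\<And>i a b. y i * a = y i * b \<Longrightarrow> a = b"
  shows "det (mat (Suc k) (Suc k) (\<lambda>(i, c). x i ^ c * y i ^ (k - c))) =
    (\<Prod>(i, j)\<in>{(i, j). i < j \<and> j \<le> k}. x j * y i - x i * y j)"
  using assms
proof (induction k arbitrary: x y)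
  case 0
  have empty: "{(i, j). i < j \<and> j = (0::nat)} = {}"
    by auto
  show ?case
    by (simp add: det_single empty)
next
  case (Suc k)
  have cancel: "a = b" if "y 0 ^ e * a = y 0 ^ e * b" for a b e
    using that by (induction e) (auto simp: mult.assoc dest: Suc.prems)
  have IH: "det (mat (Suc k) (Suc k) (\<lambda>(i, c). x (Suc i) ^ c * y (Suc i) ^ (k - c))) =
    (\<Prod>(i, j)\<in>{(i, j). i < j \<and> j \<le> k}. x (Suc j) * y (Suc i) - x (Suc i) * y (Suc j))"
    by (rule Suc.IH) (rule Suc.prems)
  show ?case
    using cancel[OF vandermonde_step[of y k x]]
    unfolding prod_pairs_shift IH .
qed

text \<open>The condition on zero divisors is removed by a deformation: over the polynomial ring in $t$
  the monic polynomials $y_i + t$ are never zero divisors, and setting $t = 0$ afterwards is a ring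
  homomorphism, which commutes with determinants and products.\<close>

lemma homogeneous_vandermonde:
  fixes x y :: "nat \<Rightarrow> 'a::comm_ring_1"
  shows "det (mat (Suc k) (Suc k) (\<lambda>(i, c). x i ^ c * y i ^ (k - c))) =
    (\<Prod>(i, j)\<in>{(i, j). i < j \<and> j \<le> k}. x j * y i - x i * y j)"
proof -
  interpret ev: comm_ring_hom "\<lambda>p :: 'a poly. poly p 0"
    by unfold_locales auto
  define U where "U i = [:x i:]" for i
  define W where "W i = [:y i, 1:]" for i
  have "a = b" if "W i * a = W i * b" for i a b
  proof -
    have "W i * (a - b) = 0"
      using that by (simp add: right_diff_distrib)
    then have "lead_coeff (W i) * lead_coeff (a - b) = 0"
      using coeff_mult_degree_sum[of "W i" "a - b"] by simp
    then have "lead_coeff (a - b) = 0"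
      by (simp add: W_def del: coeff_diff)
    then have "a - b = 0"
      by (simp only: leading_coeff_0_iff)
    then show ?thesis
      by simp
  qed
  from vandermonde_cancel[of W k U, OF this]
  have "poly (det (mat (Suc k) (Suc k) (\<lambda>(i, c). U i ^ c * W i ^ (k - c)))) 0 =
    poly (\<Prod>(i, j)\<in>{(i, j). i < j \<and> j \<le> k}. U j * W i - U i * W j) 0"
    by simp
  moreover have "map_mat (\<lambda>p. poly p 0) (mat (Suc k) (Suc k) (\<lambda>(i, c). U i ^ c * W i ^ (k - c))) =
      mat (Suc k) (Suc k) (\<lambda>(i, c). x i ^ c * y i ^ (k - c))"
    by (intro eq_matI) (auto simp: U_def W_def)
  ultimately show ?thesis
    by (simp add: U_def W_def poly_prod case_prod_unfold mult.commute flip: ev.hom_det)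
qed

section \<open>The umbral operator on determinants\<close>

lemma umbral_sum: "umbral l d P (\<Sum>i\<in>I. f i) = (\<Sum>i\<in>I. umbral l d P (f i))"
proof (induction I rule: infinite_finite_induct)
  case (insert i I)
  then show ?case by (simp add: umbral_add)
qed (simp_all add: umbral_def)

lemma Const_of_int: "(Const (of_int k) :: ('v, 'a::comm_ring_1) mpoly) = of_int k"
proof -
  have nat: "(Const (of_nat k) :: ('v, 'a) mpoly) = of_nat k" for k
    by (induction k) (simp_all add: Const_def single_add)
  have "(Const (- c) :: ('v, 'a) mpoly) = - Const c" for c
    by (simp add: Const_def single_uminus)
  then show ?thesis
    by (cases k) (simp_all add: nat del: of_nat_Suc)
qed

lemma umbral_of_int_mult: "umbral l d P (of_int k * p) = of_int k * umbral l d P p"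
  by (metis Const_of_int umbral_scale)

text \<open>An index with exponents $(0, 0)$ does not occur in the monomial and contributes the factor
  $1$ to its image, whereas for a positive index \<open>umbral_pair\<close> at $(0, 0)$ is $0$ or a coefficient of a
  form; this is why such exponents are excluded.\<close>

lemma umbral_prod_pairs:
  assumes "finite I" "\<And>i. i \<in> I \<Longrightarrow> (e i, f i) \<noteq> (0, 0)"
  shows "umbral l d P (\<Prod>i\<in>I. Var (X i) ^ e i * Var (Y i) ^ f i) = (\<Prod>i\<in>I. umbral_pair l d P i (e i) (f i))"
proof -
  define t where "t I = (\<Sum>i\<in>I. Poly_Mapping.single (X i) (e i) + Poly_Mapping.single (Y i) (f i))" for I
  have monom: "(\<Prod>i\<in>I. Var (X i) ^ e i * Var (Y i) ^ f i) = Poly_Mapping.single (t I) 1"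
    using assms(1)
    by induction (simp_all add: t_def single_one Var_power mult_single)
  have lookup: "Poly_Mapping.lookup (t I) (X i) = (if i \<in> I then e i else 0)"
      "Poly_Mapping.lookup (t I) (Y i) = (if i \<in> I then f i else 0)" for i
    using assms(1)
    by (simp_all add: t_def lookup_sum lookup_add lookup_single when_def sum.delta)
  have "monom_indices (t I) = I"
    using assms(2) by (auto simp: monom_indices_def lookup)
  then show ?thesis
    by (simp add: monom umbral_single umbral_monom_def lookup Const_def single_one)
qed

text \<open>Every Leibniz term takes one entry from each row, so its factors belong to distinct indices
  and their images multiply.\<close>

lemma umbral_det:
  assumes "\<And>i c. i < k \<Longrightarrow> c < k \<Longrightarrow> (e i c, f i c) \<noteq> (0, 0)"
  shows "(umbral l d P (det (mat k k (\<lambda>(i, c). Var (X i) ^ e i c * Var (Y i) ^ f i c))) ::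
      (form_var, 'a::comm_ring_1) mpoly) =
    det (mat k k (\<lambda>(i, c). umbral_pair l d P i (e i c) (f i c)))"
proof -
  have perm: "p i < k" if "p permutes {0..<k}" "i < k" for p i
    using permutes_in_image[OF that(1), of i] that(2) by simp
  have "umbral l d P (\<Prod>i = 0..<k. Var (X i) ^ e i (p i) * Var (Y i) ^ f i (p i)) =
      (\<Prod>i = 0..<k. umbral_pair l d P i (e i (p i)) (f i (p i)) :: (form_var, 'a) mpoly)"
    if "p permutes {0..<k}" for p
    by (rule umbral_prod_pairs) (use assms perm[OF that] in auto)
  then show ?thesis
    by (subst (1 2) det_def'[where n = k])
      (auto simp: umbral_sum umbral_of_int_mult perm intro!: sum.cong)
qed

section \<open>The joint covariant\<close>

text \<open>The offset \<open>s\<close> serves the two products of brackets, whose indices start at $1$ and at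
  $0$.\<close>

lemma bracket_vandermonde:
  "(\<Prod>(i, j)\<in>{(i, j). i < j \<and> j \<le> k}. bracket (s + j) (s + i)) =
    det (mat (Suc k) (Suc k) (\<lambda>(i, c). Var (X (s + i)) ^ c * Var (Y (s + i)) ^ (k - c)))"
  unfolding bracket_def by (rule homogeneous_vandermonde[symmetric])

text \<open>The entries of row \<open>i\<close> after a factor $x_i^{\pi(i)-1} y_i^{n-m+1-\pi(i)}$ has been absorbed into
  the rows that belong to the first form.  For $i \ge 1$ the total degree is then exactly the degree of the
  form that \<open>i\<close> represents, and the shift of the exponent of $x_i$ turns row \<open>i\<close> of the result into row
  $\pi(i)$ of the covariant matrix.  The rows outside $\{1, \ldots, n - m + 1\}$ are fixed by $\pi$.\<close>

lemma umbral_pair_covariant_matrix: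
  assumes mn: "m \<le> n" "1 \<le> 2 * m - n" and part: "infinite_partition (2 * m - n) P"
    and P1: "{1..n - m + 1} \<subseteq> P 1" and Pj: "\<And>j. j \<in> {2..2 * m - n} \<Longrightarrow> n - m + j \<in> P j"
    and i: "i \<le> m" and c: "c \<le> m" and \<pi>: "\<pi> permutes {1..n - m + 1}"
  shows "umbral_pair (2 * m - n) (form_degrees n m) P i
      (c + (if i \<in> {1..n - m + 1} then \<pi> i - 1 else 0))
      (m - c + (if i \<in> {1..n - m + 1} then n - m + 1 - \<pi> i else 0)) =
    covariant_matrix n m $$ (\<pi> i, c)"
proof -
  have the: "(THE j. j \<in> {1..2 * m - n} \<and> i \<in> P j) = j" if "j \<in> {1..2 * m - n}" "i \<in> P j" for j
    using that part unfolding infinite_partition_def disjoint_family_on_def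
    by (intro the_equality) blast+
  consider "i = 0" | "i \<in> {1..n - m + 1}" | "i > n - m + 1"
    by force
  then show ?thesis
  proof cases
    case 1
    then have "\<pi> i = 0"
      using permutes_not_in[OF \<pi>, of i] by simp
    then show ?thesis
      using 1 c by (simp add: umbral_pair_def covariant_matrix_def)
  next
    case 2
    have "\<pi> i \<in> {1..n - m + 1}"
      using permutes_in_image[OF \<pi>] 2 by blast
    moreover have "(THE j. j \<in> {1..2 * m - n} \<and> i \<in> P j) = 1"
      by (rule the) (use 2 P1 mn in auto)
    ultimately show ?thesis
      using 2 c mn by (auto simp: umbral_pair_def covariant_matrix_def form_degrees_def add.commute)
  next
    case 3
    have "\<pi> i = i"
      using permutes_not_in[OF \<pi>, of i] 3 by simp
    moreover have "(THE j. j \<in> {1..2 * m - n} \<and> i \<in> P j) = i - (n - m)"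
    proof (rule the)
      have j: "i - (n - m) \<in> {2..2 * m - n}"
        using 3 i mn by auto
      then show "i - (n - m) \<in> {1..2 * m - n}"
        by simp
      show "i \<in> P (i - (n - m))"
        using Pj[OF j] 3 by simp
    qed
    ultimately show ?thesis
      using 3 c i mn by (auto simp: umbral_pair_def covariant_matrix_def form_degrees_def Let_def)
  qed
qed

theorem theorem4:
  fixes n m l :: nat and P :: "nat \<Rightarrow> nat set"
  assumes "n \<ge> 1" and "m \<ge> 1" and "m \<le> n"
    and "l = 2 * m - n" and "l \<ge> 1"
    and "infinite_partition l P"
    and "{1..n - m + 1} \<subseteq> P 1"
    and "\<And>j. j \<in> {2..l} \<Longrightarrow> n - m + j \<in> P j"
  shows "(joint_covariant n m P :: (form_var, 'a::field_char_0) mpoly) =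
    of_nat (fact (n - m + 1)) * det (covariant_matrix n m)"
proof -
  define k where "k = n - m"
  define C :: "(form_var, 'a) mpoly mat" where "C = covariant_matrix n m"
  let ?x = "\<lambda>i. Var (X i) :: (xy_var, 'a) mpoly" and ?y = "\<lambda>i. Var (Y i) :: (xy_var, 'a) mpoly"
  let ?U = "umbral l (form_degrees n m) P"
  (* The permutations of the small determinant act on {0..k}, but the rows of C that they permute
     are those with indices 1, ..., k + 1; lift transports them, keeping the sign. *)
  define lift where "lift \<sigma> = map_permutation {0..<Suc k} Suc \<sigma>" for \<sigma>
  (* The exponents of x_i and y_i in column c after the factor of the small determinant that
     belongs to i has been absorbed into row i of the large one. *)
  define e where "e \<sigma> i c = c + (if i \<in> {1..k + 1} then lift \<sigma> i - 1 else 0)" for \<sigma> i c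
  define f where "f \<sigma> i c = m - c + (if i \<in> {1..k + 1} then k + 1 - lift \<sigma> i else 0)" for \<sigma> i c
  have km: "k + 1 \<le> m"
    using assms by (auto simp: k_def)
  have lift: "lift \<sigma> permutes {1..k + 1}" "sign (lift \<sigma>) = sign \<sigma>"
    "\<And>i. i < Suc k \<Longrightarrow> lift \<sigma> (Suc i) = Suc (\<sigma> i)" if "\<sigma> permutes {0..<Suc k}" for \<sigma>
  proof -
    have "bij_betw Suc {0..<Suc k} {1..k + 1}"
      by (auto simp: bij_betw_def image_Suc_atLeastLessThan)
    then show "lift \<sigma> permutes {1..k + 1}"
      unfolding lift_def using that by (rule map_permutation_permutes)
    show "sign (lift \<sigma>) = sign \<sigma>"
      unfolding lift_def by (rule sign_map_permutation) (use that in auto)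
    show "lift \<sigma> (Suc i) = Suc (\<sigma> i)" if "i < Suc k" for i
      unfolding lift_def by (rule map_permutation_apply) (use that in auto)
  qed
  have "(\<Prod>(i, j)\<in>{(i, j). 1 \<le> i \<and> i < j \<and> j \<le> n - m + 1}. bracket j i) =
      (\<Prod>(i, j)\<in>{(i, j). i < j \<and> j \<le> k}. bracket (1 + j) (1 + i) :: (xy_var, 'a) mpoly)"
    by (rule prod.reindex_bij_witness[of _ "map_prod Suc Suc" "map_prod (\<lambda>i. i - 1) (\<lambda>i. i - 1)"])
      (auto simp: k_def)
  also have "\<dots> = det (mat (Suc k) (Suc k) (\<lambda>(i, c). ?x (1 + i) ^ c * ?y (1 + i) ^ (k - c)))"
    by (rule bracket_vandermonde)
  also have "\<dots> = (\<Sum>\<sigma> | \<sigma> permutes {0..<Suc k}. of_int (sign \<sigma>) *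
      (\<Prod>i = 0..<Suc k. ?x (Suc i) ^ \<sigma> i * ?y (Suc i) ^ (k - \<sigma> i)))"
  proof -
    have "\<sigma> i < Suc k" if "\<sigma> permutes {0..<Suc k}" "i < Suc k" for \<sigma> i
      using permutes_in_image[OF that(1), of i] that(2) by simp
    then show ?thesis
      by (subst det_def') (auto intro!: sum.cong prod.cong simp del: prod.op_ivl_Suc)
  qed
  finally have small: "(\<Prod>(i, j)\<in>{(i, j). 1 \<le> i \<and> i < j \<and> j \<le> n - m + 1}. bracket j i) = \<dots>" .
  have big: "(\<Prod>(i, j)\<in>{(i, j). i < j \<and> j \<le> m}. bracket j i) =
      det (mat (Suc m) (Suc m) (\<lambda>(i, c). ?x i ^ c * ?y i ^ (m - c)))"
    using bracket_vandermonde[of 0 m] by simp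
  have scaled: "(\<Prod>i = 0..<Suc k. ?x (Suc i) ^ \<sigma> i * ?y (Suc i) ^ (k - \<sigma> i)) *
        det (mat (Suc m) (Suc m) (\<lambda>(i, c). ?x i ^ c * ?y i ^ (m - c))) =
      det (mat (Suc m) (Suc m) (\<lambda>(i, c). ?x i ^ e \<sigma> i c * ?y i ^ f \<sigma> i c))"
    if \<sigma>: "\<sigma> permutes {0..<Suc k}" for \<sigma>
  proof -
    let ?h = "\<lambda>i. if i \<in> {1..k + 1} then ?x i ^ (lift \<sigma> i - 1) * ?y i ^ (k + 1 - lift \<sigma> i) else 1"
    have "(\<Prod>i = 0..<Suc k. ?x (Suc i) ^ \<sigma> i * ?y (Suc i) ^ (k - \<sigma> i)) = (\<Prod>i = 0..<Suc k. ?h (Suc i))"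
      by (rule prod.cong) (simp_all add: lift(3)[OF \<sigma>])
    also have "\<dots> = (\<Prod>i\<in>{1..k + 1}. ?h i)"
      by (rule prod.reindex_bij_witness[of _ "\<lambda>i. i - 1" Suc]) auto
    also have "\<dots> = (\<Prod>i<Suc m. ?h i)"
      by (rule prod.mono_neutral_left) (use km in auto)
    finally show ?thesis
      by (simp only: flip: det_scale_rows)
        (auto intro!: arg_cong[of _ _ det] cong_mat simp: e_def f_def power_add mult_ac)
  qed
  have image: "?U (det (mat (Suc m) (Suc m) (\<lambda>(i, c). ?x i ^ e \<sigma> i c * ?y i ^ f \<sigma> i c))) =
      of_int (sign \<sigma>) * det C"
    if \<sigma>: "\<sigma> permutes {0..<Suc k}" for \<sigma>
  proof -
    have "?U (det (mat (Suc m) (Suc m) (\<lambda>(i, c). ?x i ^ e \<sigma> i c * ?y i ^ f \<sigma> i c))) =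
        det (mat (Suc m) (Suc m) (\<lambda>(i, c). umbral_pair l (form_degrees n m) P i (e \<sigma> i c) (f \<sigma> i c)))"
      by (rule umbral_det) (use \<open>m \<ge> 1\<close> in \<open>auto simp: e_def f_def\<close>)
    also have "\<dots> = det (mat (Suc m) (Suc m) (\<lambda>(i, c). C $$ (lift \<sigma> i, c)))"
    proof -
      have "umbral_pair l (form_degrees n m) P i (e \<sigma> i c) (f \<sigma> i c) = C $$ (lift \<sigma> i, c)"
        if "i < Suc m" "c < Suc m" for i c
        unfolding e_def f_def C_def k_def \<open>l = 2 * m - n\<close>
        by (rule umbral_pair_covariant_matrix)
          (use assms lift(1)[OF \<sigma>] that in \<open>auto simp: k_def\<close>)
      then show ?thesis
        by (intro arg_cong[of _ _ det] cong_mat) simp_all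
    qed
    also have "\<dots> = of_int (sign (lift \<sigma>)) * det C"
    proof (rule det_permute_rows)
      show "C \<in> carrier_mat (Suc m) (Suc m)"
        by (simp add: C_def covariant_matrix_def)
      show "lift \<sigma> permutes {0..<Suc m}"
        by (rule permutes_subset[OF lift(1)[OF \<sigma>]]) (use km in auto)
    qed
    finally show ?thesis
      by (simp add: lift(2)[OF \<sigma>])
  qed
  have "joint_covariant n m P = ?U (\<Sum>\<sigma> | \<sigma> permutes {0..<Suc k}.
      of_int (sign \<sigma>) * det (mat (Suc m) (Suc m) (\<lambda>(i, c). ?x i ^ e \<sigma> i c * ?y i ^ f \<sigma> i c)))"
    unfolding joint_covariant_def small big sum_distrib_right \<open>l = 2 * m - n\<close>
    by (intro arg_cong[of _ _ "umbral _ _ _"] sum.cong) (simp_all only: mult.assoc scaled mem_Collect_eq)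
  also have "\<dots> = (\<Sum>\<sigma> | \<sigma> permutes {0..<Suc k}. of_int (sign \<sigma>) * (of_int (sign \<sigma>) * det C))"
    by (simp add: umbral_sum umbral_of_int_mult image)
  also have "\<dots> = (\<Sum>\<sigma> | \<sigma> permutes {0..<Suc k}. det C)"
    by (rule sum.cong) (simp_all flip: mult.assoc of_int_mult)
  also have "\<dots> = of_nat (fact (n - m + 1)) * det C"
    by (simp add: card_permutations[of _ "Suc k"] k_def del: fact_Suc of_nat_fact)
  finally show ?thesis
    unfolding C_def .
qed

end
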